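(* Let $p \colon E \to B$ be an LEC fibration such that $E \times_B E$ is paracompact Hausdorff. If $\{U_i\}_{i=0}^{k}$ is an open cover of $E \times_B E$ with sections $s_i \colon U_i \to E^{I}_B$ of $\Pi$ such that $\Delta E \subset U_0$ and $\Delta E \cap U_i = \emptyset$ for all $i \ge 1$, then $$\mathrm{TC}^{M}[p \colon E \to B] \leq k.$$ Moreover, if $\mathrm{TC}[p \colon E \to B] = k$, then $$\mathrm{TC}^M[p \colon E \to B] = \mathrm{TC}[p \colon E \to B] = k.$$
   Context: Fibration means Hurewicz fibration, $I=[0,1]$. For a fibration $p \colon E \to B$: $E \times_B E = \{(e_1,e_2)\in E\times E \mid p(e_1)=p(e_2)\}$; $\Delta_E \colon E \to E \times_B E$, $e \mapsto (e,e)$, is the diagonal inclusion, with image $\Delta E$; $E^I_B = \{\gamma \in E^I \mid p\circ\gamma \text{ is constant}\}$ (subspace of $E^I$ with compact-open topology); $\Pi \colon E^I_B \to E \times_B E$, $\Pi(\gamma) = (\gamma(0),\gamma(1))$, which is a fibration; $\mathrm{c}_e$ is the constant path at $e$. $p$ is an LEC fibration if it is a fibration and $\Delta_E$ is a closed cofibration. $\mathrm{TC}[p \colon E\to B]$ (parametrized topological complexity) is the sectional category of $\Pi$: the least nonnegative integer $n$ such that $E \times_B E$ has an open cover $\{V_0,\dots,V_n\}$ with a continuous section of $\Pi$ over each $V_i$ ($\infty$ if none exists). $\mathrm{TC}^{M}[p \colon E\to B]$ (monoidal parametrized topological complexity) is the least nonnegative integer $n$ such that $E \times_B E$ may be covered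 by open subsets $V_0,\dots,V_n$, each containing $\Delta E$ and admitting a section $\sigma_i \colon V_i \to E^I_B$ of $\Pi$ with $\sigma_i(e,e) = \mathrm{c}_e$ for all $e \in E$ ($\infty$ if none exists). *)

theory Defs
  imports "HOL-Analysis.Analysis" "HOL-Library.Extended_Nat"
begin

section \<open>Paracompactness and the compact-open topology\<close>

definition paracompact_space :: "'a topology \<Rightarrow> bool" where
  "paracompact_space X \<longleftrightarrow>
     (\<forall>\<U>. (\<forall>U\<in>\<U>. openin X U) \<and> \<Union>\<U> = topspace X \<longrightarrow>
        (\<exists>\<V>. (\<forall>V\<in>\<V>. openin X V) \<and> \<Union>\<V> = topspace X \<and>
             (\<forall>V\<in>\<V>. \<exists>U\<in>\<U>. V \<subseteq> U) \<and> locally_finite_in X \<V>))"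

text \<open>A map out of \<open>X\<close> is represented by the unique function that has the prescribed values on
  \<open>topspace X\<close> and is \<open>undefined\<close> elsewhere.\<close>

definition continuous_maps :: "'a topology \<Rightarrow> 'b topology \<Rightarrow> ('a \<Rightarrow> 'b) set" where
  "continuous_maps X Y = {f \<in> extensional (topspace X). continuous_map X Y f}"

definition compact_open :: "'a topology \<Rightarrow> 'b topology \<Rightarrow> ('a \<Rightarrow> 'b) topology" where
  "compact_open X Y =
     topology_generated_by
       {{f \<in> continuous_maps X Y. f ` K \<subseteq> U} | K U. compactin X K \<and> openin Y U}"

abbreviation unit_interval :: "real topology" where
  "unit_interval \<equiv> top_of_set {0..1}"

lemma topspace_compact_open [simp]:
  "topspace (compact_open X Y) = continuous_maps X Y"
proof -
  have "continuous_maps X Y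
      \<in> {{f \<in> continuous_maps X Y. f ` K \<subseteq> U} | K U. compactin X K \<and> openin Y U}"
    by (intro CollectI exI[of _ "{}"]) auto
  then show ?thesis
    unfolding compact_open_def topology_generated_by_topspace by blast
qed

lemma continuous_map_eval_compact_open:
  assumes nb: "neighbourhood_base_of (compactin X) X"
  shows "continuous_map (prod_topology (compact_open X Y) X) Y (\<lambda>(f, x). f x)"
  unfolding continuous_map
proof (intro conjI allI impI)
  show "(\<lambda>(f, x). f x) ` topspace (prod_topology (compact_open X Y) X) \<subseteq> topspace Y"
    by (auto simp: continuous_maps_def continuous_map_def)
next
  fix U assume U: "openin Y U"
  let ?P = "{z \<in> topspace (prod_topology (compact_open X Y) X). (case z of (f, x) \<Rightarrow> f x) \<in> U}"
  show "openin (prod_topology (compact_open X Y) X) ?P"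
    unfolding openin_prod_topology_alt
  proof (intro allI impI)
    fix f x assume "(f, x) \<in> ?P"
    then have f: "f \<in> continuous_maps X Y" and x: "x \<in> topspace X" and fx: "f x \<in> U"
      by auto
    have "openin X {y \<in> topspace X. f y \<in> U}"
      using f U by (auto simp: continuous_maps_def continuous_map_def)
    then obtain V K where V: "openin X V" and K: "compactin X K"
      and xV: "x \<in> V" and VK: "V \<subseteq> K" and KU: "K \<subseteq> {y \<in> topspace X. f y \<in> U}"
      using nb x fx unfolding neighbourhood_base_of by (metis (no_types, lifting) mem_Collect_eq)
    let ?W = "{g \<in> continuous_maps X Y. g ` K \<subseteq> U}"
    have "openin (compact_open X Y) ?W"
      unfolding compact_open_def using K U by (intro topology_generated_by_Basis) blast
    moreover have "f \<in> ?W" using f KU by auto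
    moreover have "?W \<times> V \<subseteq> ?P"
      using VK openin_subset[OF V] by auto
    ultimately show "\<exists>W V. openin (compact_open X Y) W \<and> openin X V \<and> f \<in> W \<and> x \<in> V \<and> W \<times> V \<subseteq> ?P"
      using V xV by blast
  qed
qed

lemma continuous_map_curry_compact_open:
  assumes H: "continuous_map (prod_topology W X) Y H"
  shows "continuous_map W (compact_open X Y) (\<lambda>w. restrict (\<lambda>x. H (w, x)) (topspace X))"
proof -
  have cm: "restrict (\<lambda>x. H (w, x)) (topspace X) \<in> continuous_maps X Y" if "w \<in> topspace W" for w
  proof -
    have "continuous_map X (prod_topology W X) (\<lambda>x. (w, x))"
      using that by (simp add: continuous_map_pairedI)
    then have "continuous_map X Y (\<lambda>x. H (w, x))"
      using continuous_map_compose[OF _ H] by (simp add: o_def)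
    then show ?thesis
      unfolding continuous_maps_def
      by (auto intro: continuous_map_eq[of X Y "\<lambda>x. H (w, x)"])
  qed
  show ?thesis
    unfolding compact_open_def
  proof (rule continuous_on_generated_topo)
    show "(\<lambda>w. restrict (\<lambda>x. H (w, x)) (topspace X)) ` topspace W
      \<subseteq> \<Union>{{f \<in> continuous_maps X Y. f ` K \<subseteq> U} | K U. compactin X K \<and> openin Y U}"
      using cm topspace_compact_open[of X Y, unfolded compact_open_def topology_generated_by_topspace]
      by blast
  next
    fix S assume "S \<in> {{f \<in> continuous_maps X Y. f ` K \<subseteq> U} | K U. compactin X K \<and> openin Y U}"
    then obtain K U where S: "S = {f \<in> continuous_maps X Y. f ` K \<subseteq> U}"
      and K: "compactin X K" and U: "openin Y U" by blast
    have KX: "K \<subseteq> topspace X" using K compactin_subset_topspace by blast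
    let ?Q = "{z \<in> topspace (prod_topology W X). H z \<in> U}"
    have Q: "openin (prod_topology W X) ?Q"
      using H U by (auto simp: continuous_map_def)
    let ?g = "\<lambda>w. restrict (\<lambda>x. H (w, x)) (topspace X)"
    show "openin W (?g -` S \<inter> topspace W)"
    proof (subst openin_subopen, intro ballI)
      fix w assume w: "w \<in> ?g -` S \<inter> topspace W"
      then have wW: "w \<in> topspace W" and wK: "{w} \<times> K \<subseteq> ?Q"
        using KX by (auto simp: S)
      have cw: "compactin W {w}" using wW by simp
      obtain V V' where V: "openin W V" "{w} \<subseteq> V" "K \<subseteq> V'" "V \<times> V' \<subseteq> ?Q"
        by (rule Wallace_theorem_prod_topology[OF cw K Q wK])
      have "v \<in> ?g -` S \<inter> topspace W" if v: "v \<in> V" for v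
      proof -
        have vW: "v \<in> topspace W" using v openin_subset[OF V(1)] by blast
        moreover have "H (v, x) \<in> U" if "x \<in> K" for x
          using that v V(3,4) by blast
        ultimately show ?thesis
          using KX cm[OF vW] unfolding S by auto
      qed
      then have "V \<subseteq> ?g -` S \<inter> topspace W" by blast
      then show "\<exists>T. openin W T \<and> w \<in> T \<and> T \<subseteq> ?g -` S \<inter> topspace W"
        using V by blast
    qed
  qed
qed

lemma neighbourhood_base_unit_interval:
  "neighbourhood_base_of (compactin unit_interval) unit_interval"
proof -
  have "compact_space unit_interval"
    by (simp add: compact_space_subtopology)
  moreover have "Hausdorff_space unit_interval"
    by (simp add: Hausdorff_space_subtopology)
  ultimately show ?thesis
    by (meson compact_imp_locally_compact_space locally_compact_space_neighbourhood_base)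
qed

section \<open>Hurewicz fibrations\<close>

definition homotopy_lifting_property ::
    "'x topology \<Rightarrow> 'e topology \<Rightarrow> 'b topology \<Rightarrow> ('e \<Rightarrow> 'b) \<Rightarrow> bool" where
  "homotopy_lifting_property X E B p \<longleftrightarrow>
     (\<forall>f H. continuous_map X E f \<and> continuous_map (prod_topology X unit_interval) B H \<and>
            (\<forall>x\<in>topspace X. H (x, 0) = p (f x)) \<longrightarrow>
        (\<exists>G. continuous_map (prod_topology X unit_interval) E G \<and>
             (\<forall>x\<in>topspace X. G (x, 0) = f x) \<and>
             (\<forall>x\<in>topspace X. \<forall>t\<in>{0..1}. p (G (x, t)) = H (x, t))))"

text \<open>One cannot quantify over types inside a definition. The spaces on the type
  \<open>'e \<times> (real \<Rightarrow> 'b)\<close> include the mapping path space of \<open>p\<close> and hence suffice: the lemma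
  \<open>hurewicz_fibration_lifting\<close> below yields the lifting property for spaces on every type.\<close>

definition hurewicz_fibration :: "'e topology \<Rightarrow> 'b topology \<Rightarrow> ('e \<Rightarrow> 'b) \<Rightarrow> bool" where
  "hurewicz_fibration E B p \<longleftrightarrow>
     continuous_map E B p \<and>
     (\<forall>X :: ('e \<times> (real \<Rightarrow> 'b)) topology. homotopy_lifting_property X E B p)"

lemma hurewicz_fibration_lifting:
  fixes X :: "'x topology"
  assumes "hurewicz_fibration E B p"
  shows "homotopy_lifting_property X E B p"
  unfolding homotopy_lifting_property_def
proof (intro allI impI, elim conjE)
  fix f H
  assume f: "continuous_map X E f" and H: "continuous_map (prod_topology X unit_interval) B H"
    and H0: "\<forall>x\<in>topspace X. H (x, 0) = p (f x)"
  let ?P = "compact_open unit_interval B"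
  define N where "N = subtopology (prod_topology E ?P) {(e, w). w 0 = p e}"
  have fstN: "continuous_map N E fst" and sndN: "continuous_map N ?P snd"
    unfolding N_def
    by (auto intro: continuous_map_from_subtopology continuous_map_fst continuous_map_snd)
  have "continuous_map (prod_topology N unit_interval) (prod_topology ?P unit_interval)
          (\<lambda>z. (snd (fst z), snd z))"
    using continuous_map_compose[OF continuous_map_fst sndN]
    by (intro continuous_map_pairedI) (auto simp: o_def continuous_map_snd)
  from continuous_map_compose[OF this
      continuous_map_eval_compact_open[OF neighbourhood_base_unit_interval]]
  have ev: "continuous_map (prod_topology N unit_interval) B (\<lambda>z. snd (fst z) (snd z))"
    by (simp add: o_def)
  have "homotopy_lifting_property N E B p"
    using assms by (simp add: hurewicz_fibration_def)
  moreover have "\<forall>x\<in>topspace N. (\<lambda>z. snd (fst z) (snd z)) (x, 0) = p (fst x)"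
    by (auto simp: N_def)
  ultimately have "\<exists>G. continuous_map (prod_topology N unit_interval) E G \<and>
      (\<forall>x\<in>topspace N. G (x, 0) = fst x) \<and>
      (\<forall>x\<in>topspace N. \<forall>t\<in>{0..1}. p (G (x, t)) = (\<lambda>z. snd (fst z) (snd z)) (x, t))"
    using fstN ev unfolding homotopy_lifting_property_def by blast
  then obtain G where G: "continuous_map (prod_topology N unit_interval) E G"
    and G0: "\<forall>x\<in>topspace N. G (x, 0) = fst x"
    and pG: "\<forall>x\<in>topspace N. \<forall>t\<in>{0..1}. p (G (x, t)) = snd x t"
    by auto
  define \<phi> where "\<phi> = (\<lambda>x. (f x, restrict (\<lambda>t. H (x, t)) {0..1}))"
  have "continuous_map X ?P (\<lambda>x. restrict (\<lambda>t. H (x, t)) {0..1})"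
    using continuous_map_curry_compact_open[OF H] by simp
  then have "continuous_map X (prod_topology E ?P) \<phi>"
    unfolding \<phi>_def using f by (intro continuous_map_pairedI) auto
  then have \<phi>: "continuous_map X N \<phi>"
    using H0 by (auto simp: N_def continuous_map_in_subtopology \<phi>_def)
  have \<phi>N: "\<phi> x \<in> topspace N" if "x \<in> topspace X" for x
    using \<phi> that by (auto simp: continuous_map_def)
  have "continuous_map (prod_topology X unit_interval) (prod_topology N unit_interval)
          (\<lambda>z. (\<phi> (fst z), snd z))"
    using continuous_map_compose[OF continuous_map_fst \<phi>]
    by (intro continuous_map_pairedI) (auto simp: o_def continuous_map_snd)
  from continuous_map_compose[OF this G]
  have "continuous_map (prod_topology X unit_interval) E (\<lambda>z. G (\<phi> (fst z), snd z))"
    by (simp add: o_def)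
  moreover have "\<forall>x\<in>topspace X. G (\<phi> (fst (x, 0::real)), snd (x, 0::real)) = f x"
    using G0 \<phi>N by (simp add: \<phi>_def)
  moreover have "\<forall>x\<in>topspace X. \<forall>t\<in>{0..1}. p (G (\<phi> (fst (x, t)), snd (x, t))) = H (x, t)"
    using pG \<phi>N by (simp add: \<phi>_def)
  ultimately show "\<exists>G. continuous_map (prod_topology X unit_interval) E G \<and>
      (\<forall>x\<in>topspace X. G (x, 0) = f x) \<and>
      (\<forall>x\<in>topspace X. \<forall>t\<in>{0..1}. p (G (x, t)) = H (x, t))"
    by (intro exI conjI)
qed

section \<open>Cofibrations\<close>

definition homotopy_extension_property ::
    "'a topology \<Rightarrow> 'x topology \<Rightarrow> ('a \<Rightarrow> 'x) \<Rightarrow> 'z topology \<Rightarrow> bool" where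
  "homotopy_extension_property A X i Z \<longleftrightarrow>
     (\<forall>f h. continuous_map X Z f \<and> continuous_map (prod_topology A unit_interval) Z h \<and>
            (\<forall>a\<in>topspace A. h (a, 0) = f (i a)) \<longrightarrow>
        (\<exists>H. continuous_map (prod_topology X unit_interval) Z H \<and>
             (\<forall>x\<in>topspace X. H (x, 0) = f x) \<and>
             (\<forall>a\<in>topspace A. \<forall>t\<in>{0..1}. H (i a, t) = h (a, t))))"

text \<open>As for fibrations, one type suffices: \<open>'x + 'a \<times> real\<close> carries the mapping cylinder
  of \<open>i\<close>, and the lemma \<open>cofibration_extension\<close> below yields the extension property for targets
  on every type.\<close>

definition cofibration :: "'a topology \<Rightarrow> 'x topology \<Rightarrow> ('a \<Rightarrow> 'x) \<Rightarrow> bool" where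
  "cofibration A X i \<longleftrightarrow>
     continuous_map A X i \<and>
     (\<forall>Z :: ('x + 'a \<times> real) topology. homotopy_extension_property A X i Z)"

definition closed_cofibration :: "'a topology \<Rightarrow> 'x topology \<Rightarrow> ('a \<Rightarrow> 'x) \<Rightarrow> bool" where
  "closed_cofibration A X i \<longleftrightarrow> cofibration A X i \<and> closedin X (i ` topspace A)"

lemma cofibration_extension:
  fixes Z :: "'z topology"
  assumes "cofibration A X i"
  shows "homotopy_extension_property A X i Z"
  unfolding homotopy_extension_property_def
proof (intro allI impI, elim conjE)
  fix f h
  assume f: "continuous_map X Z f" and h: "continuous_map (prod_topology A unit_interval) Z h"
    and h0: "\<forall>a\<in>topspace A. h (a, 0) = f (i a)"
  let ?AI = "prod_topology A unit_interval"
  have i: "continuous_map A X i" using assms by (simp add: cofibration_def)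
  then have iX: "i a \<in> topspace X" if "a \<in> topspace A" for a
    using that by (auto simp: continuous_map_def)
  define j :: "'a \<times> real \<Rightarrow> 'b + 'a \<times> real" where
    "j = (\<lambda>(a, t). if t = 0 then Inl (i a) else Inr (a, t))"
  define C where "C = Inl ` topspace X \<union> j ` topspace ?AI"
  define opn where "opn = (\<lambda>U. U \<subseteq> C \<and> openin X {x \<in> topspace X. Inl x \<in> U} \<and>
                            openin ?AI {z \<in> topspace ?AI. j z \<in> U})"
  define M where "M = topology opn"
  have "istopology opn"
    unfolding istopology_def
  proof (intro conjI allI impI)
    fix S T assume "opn S" "opn T"
    moreover have "{x \<in> topspace X. Inl x \<in> S \<inter> T}
        = {x \<in> topspace X. Inl x \<in> S} \<inter> {x \<in> topspace X. Inl x \<in> T}"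
      "{z \<in> topspace ?AI. j z \<in> S \<inter> T} = {z \<in> topspace ?AI. j z \<in> S} \<inter> {z \<in> topspace ?AI. j z \<in> T}"
      by auto
    ultimately show "opn (S \<inter> T)"
      unfolding opn_def by (auto intro!: openin_Int simp del: Int_iff)
  next
    fix \<K> assume *: "\<forall>K\<in>\<K>. opn K"
    have "{x \<in> topspace X. Inl x \<in> \<Union>\<K>} = (\<Union>K\<in>\<K>. {x \<in> topspace X. Inl x \<in> K})"
      "{z \<in> topspace ?AI. j z \<in> \<Union>\<K>} = (\<Union>K\<in>\<K>. {z \<in> topspace ?AI. j z \<in> K})"
      by auto
    moreover have "openin X (\<Union>K\<in>\<K>. {x \<in> topspace X. Inl x \<in> K})"
      "openin ?AI (\<Union>K\<in>\<K>. {z \<in> topspace ?AI. j z \<in> K})"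
      using * by (auto simp: opn_def)
    moreover have "\<Union>\<K> \<subseteq> C" using * by (auto simp: opn_def)
    ultimately show "opn (\<Union>\<K>)" unfolding opn_def by presburger
  qed
  then have openM: "openin M U \<longleftrightarrow> opn U" for U
    by (simp add: M_def)
  have "opn C"
  proof -
    have "{x \<in> topspace X. Inl x \<in> C} = topspace X" "{z \<in> topspace ?AI. j z \<in> C} = topspace ?AI"
      by (auto simp: C_def)
    then show ?thesis unfolding opn_def by (metis openin_topspace order_refl)
  qed
  then have topM: "topspace M = C"
    using openM unfolding opn_def topspace_def by blast
  have inl: "continuous_map X M Inl"
    unfolding continuous_map_def topM openM by (auto simp: opn_def C_def)
  have j: "continuous_map ?AI M j"
    unfolding continuous_map_def topM openM by (auto simp: opn_def C_def)
  define g where "g = case_sum f h"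
  have gj: "g (j z) = h z" if "z \<in> topspace ?AI" for z
    using that h0 by (auto simp: g_def j_def split: if_splits)
  have g: "continuous_map M Z g"
    unfolding continuous_map
  proof (intro conjI allI impI)
    show "g ` topspace M \<subseteq> topspace Z"
      using gj f h by (auto simp: topM C_def continuous_map_def g_def Pi_iff image_subset_iff)
  next
    fix W assume W: "openin Z W"
    have "{x \<in> topspace X. Inl x \<in> {m \<in> topspace M. g m \<in> W}} = {x \<in> topspace X. f x \<in> W}"
      by (auto simp: topM C_def g_def)
    moreover have "{z \<in> topspace ?AI. j z \<in> {m \<in> topspace M. g m \<in> W}} = {z \<in> topspace ?AI. h z \<in> W}"
    proof (rule Collect_cong)
      fix z
      have "j z \<in> topspace M" if "z \<in> topspace ?AI"
        using that by (auto simp only: topM C_def)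
      then show "(z \<in> topspace ?AI \<and> j z \<in> {m \<in> topspace M. g m \<in> W})
          \<longleftrightarrow> (z \<in> topspace ?AI \<and> h z \<in> W)"
        using gj[of z] by (metis mem_Collect_eq)
    qed
    moreover have "openin X {x \<in> topspace X. f x \<in> W}" "openin ?AI {z \<in> topspace ?AI. h z \<in> W}"
      using f h W by (auto simp: continuous_map_def)
    moreover have "{m \<in> topspace M. g m \<in> W} \<subseteq> C" by (auto simp: topM)
    ultimately show "openin M {m \<in> topspace M. g m \<in> W}"
      unfolding openM opn_def by presburger
  qed
  have "homotopy_extension_property A X i M"
    using assms by (simp add: cofibration_def)
  moreover have "\<forall>a\<in>topspace A. j (a, 0) = Inl (i a)"
    by (simp add: j_def)
  ultimately have "\<exists>H. continuous_map (prod_topology X unit_interval) M H \<and>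
      (\<forall>x\<in>topspace X. H (x, 0) = Inl x) \<and>
      (\<forall>a\<in>topspace A. \<forall>t\<in>{0..1}. H (i a, t) = j (a, t))"
    using inl j unfolding homotopy_extension_property_def by blast
  then obtain H where H: "continuous_map (prod_topology X unit_interval) M H"
    and H0: "\<forall>x\<in>topspace X. H (x, 0) = Inl x"
    and Hj: "\<forall>a\<in>topspace A. \<forall>t\<in>{0..1}. H (i a, t) = j (a, t)"
    by auto
  have "continuous_map (prod_topology X unit_interval) Z (g \<circ> H)"
    using continuous_map_compose[OF H g] .
  moreover have "\<forall>x\<in>topspace X. (g \<circ> H) (x, 0) = f x"
    using H0 by (simp add: g_def)
  moreover have "\<forall>a\<in>topspace A. \<forall>t\<in>{0..1}. (g \<circ> H) (i a, t) = h (a, t)"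
    using Hj gj by simp
  ultimately show "\<exists>H. continuous_map (prod_topology X unit_interval) Z H \<and>
      (\<forall>x\<in>topspace X. H (x, 0) = f x) \<and>
      (\<forall>a\<in>topspace A. \<forall>t\<in>{0..1}. H (i a, t) = h (a, t))"
    by (intro exI conjI)
qed

section \<open>Fibrewise path spaces\<close>

definition fibre_product :: "'e topology \<Rightarrow> ('e \<Rightarrow> 'b) \<Rightarrow> ('e \<times> 'e) topology" where
  "fibre_product E p = subtopology (prod_topology E E) {(e1, e2). p e1 = p e2}"

definition diagonal_map :: "'e \<Rightarrow> 'e \<times> 'e" where
  "diagonal_map e = (e, e)"

definition diagonal :: "'e topology \<Rightarrow> ('e \<times> 'e) set" where
  "diagonal E = diagonal_map ` topspace E"

definition fibrewise_path_space :: "'e topology \<Rightarrow> ('e \<Rightarrow> 'b) \<Rightarrow> (real \<Rightarrow> 'e) topology" where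
  "fibrewise_path_space E p =
     subtopology (compact_open unit_interval E) {\<gamma>. \<exists>b. \<forall>t\<in>{0..1}. p (\<gamma> t) = b}"

definition path_endpoints :: "(real \<Rightarrow> 'e) \<Rightarrow> 'e \<times> 'e" where
  "path_endpoints \<gamma> = (\<gamma> 0, \<gamma> 1)"

definition constant_path :: "'e \<Rightarrow> real \<Rightarrow> 'e" where
  "constant_path e = restrict (\<lambda>_. e) {0..1}"

definition LEC_fibration :: "'e topology \<Rightarrow> 'b topology \<Rightarrow> ('e \<Rightarrow> 'b) \<Rightarrow> bool" where
  "LEC_fibration E B p \<longleftrightarrow>
     hurewicz_fibration E B p \<and> closed_cofibration E (fibre_product E p) diagonal_map"

section \<open>Sectional category and parametrized topological complexity\<close>

definition continuous_section_over ::
    "'x topology \<Rightarrow> 'y topology \<Rightarrow> ('x \<Rightarrow> 'y) \<Rightarrow> 'y set \<Rightarrow> ('y \<Rightarrow> 'x) \<Rightarrow> bool" where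
  "continuous_section_over X Y q V s \<longleftrightarrow>
     continuous_map (subtopology Y V) X s \<and> (\<forall>y\<in>V. q (s y) = y)"

definition open_cover_upto :: "'y topology \<Rightarrow> nat \<Rightarrow> (nat \<Rightarrow> 'y set) \<Rightarrow> bool" where
  "open_cover_upto Y n V \<longleftrightarrow> (\<forall>i\<le>n. openin Y (V i)) \<and> (\<Union>i\<le>n. V i) = topspace Y"

text \<open>The infimum of the empty set in \<^typ>\<open>enat\<close> is \<open>\<infinity>\<close>.\<close>

definition sectional_category ::
    "'x topology \<Rightarrow> 'y topology \<Rightarrow> ('x \<Rightarrow> 'y) \<Rightarrow> enat" where
  "sectional_category X Y q =
     Inf {enat n | n. \<exists>V. open_cover_upto Y n V \<and>
            (\<forall>i\<le>n. \<exists>s. continuous_section_over X Y q (V i) s)}"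

definition parametrized_TC :: "'e topology \<Rightarrow> ('e \<Rightarrow> 'b) \<Rightarrow> enat" where
  "parametrized_TC E p =
     sectional_category (fibrewise_path_space E p) (fibre_product E p) path_endpoints"

definition monoidal_parametrized_TC :: "'e topology \<Rightarrow> ('e \<Rightarrow> 'b) \<Rightarrow> enat" where
  "monoidal_parametrized_TC E p =
     Inf {enat n | n. \<exists>V. open_cover_upto (fibre_product E p) n V \<and>
            (\<forall>i\<le>n. diagonal E \<subseteq> V i \<and>
               (\<exists>\<sigma>. continuous_section_over (fibrewise_path_space E p) (fibre_product E p)
                       path_endpoints (V i) \<sigma> \<and>
                    (\<forall>e\<in>topspace E. \<sigma> (e, e) = constant_path e)))}"

end

theory Submission
  imports Defs
begin

text \<open>A section \<open>s\<close> of \<open>\<Pi>\<close> over an open neighbourhood \<open>U 0\<close> of the diagonal can be made strict.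
  The concatenation of the reverse of \<open>s (e1, e1)\<close> with \<open>s (e1, e2)\<close> is again a section, and its value
  on the diagonal is canonically contractible to the constant path. As the diagonal is a closed
  cofibration and \<open>p\<close> a fibration, this contraction extends, fibrewise, to a deformation over all of
  \<open>U 0\<close>, whose end is a strict section. By normality the diagonal and the complement of \<open>U 0\<close>
  have disjoint open neighbourhoods \<open>Q\<close> and \<open>P\<close>. On \<open>(U i \<inter> P) \<union> (U 0 \<inter> Q)\<close> the given section
  and the strict one combine, and together with \<open>U 0\<close> these sets cover.\<close>

section \<open>Normality of paracompact Hausdorff spaces\<close>

text \<open>Refine the cover by the complement of \<open>S\<close> and all open sets separated from
  \<open>T\<close> to a locally finite one, and take the members meeting \<open>S\<close>. By local
  finiteness the closure of their union is the union of their closures, each of which misses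
  \<open>T\<close>; the complement of that closure is the neighbourhood of \<open>T\<close>.\<close>

lemma paracompact_separation:
  assumes X: "paracompact_space X" and S: "closedin X S" and T: "T \<subseteq> topspace X"
    and sep: "\<And>x. x \<in> S \<Longrightarrow> \<exists>V W. openin X V \<and> openin X W \<and> x \<in> V \<and> T \<subseteq> W \<and> disjnt V W"
  shows "\<exists>V W. openin X V \<and> openin X W \<and> S \<subseteq> V \<and> T \<subseteq> W \<and> disjnt V W"
proof -
  define \<U> where
    "\<U> = insert (topspace X - S) {V. openin X V \<and> (\<exists>W. openin X W \<and> T \<subseteq> W \<and> disjnt V W)}"
  have op: "\<forall>V\<in>\<U>. openin X V"
    using S by (auto simp: \<U>_def closedin_def)
  have "\<Union>\<U> = topspace X"
  proof
    show "\<Union>\<U> \<subseteq> topspace X"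
      using op openin_subset by blast
    show "topspace X \<subseteq> \<Union>\<U>"
    proof
      fix x assume "x \<in> topspace X"
      then show "x \<in> \<Union>\<U>"
        using sep[of x] by (cases "x \<in> S") (auto simp: \<U>_def)
    qed
  qed
  with op X obtain \<V> where \<V>: "\<forall>V\<in>\<V>. openin X V" "\<Union>\<V> = topspace X"
      "\<forall>V\<in>\<V>. \<exists>U\<in>\<U>. V \<subseteq> U" "locally_finite_in X \<V>"
    unfolding paracompact_space_def by (elim allE[of _ \<U>] impE) auto
  define \<W> where "\<W> = {V \<in> \<V>. V \<inter> S \<noteq> {}}"
  have "locally_finite_in X \<W>"
    using \<V>(4) by (rule locally_finite_in_subset) (auto simp: \<W>_def)
  then have cl: "X closure_of \<Union>\<W> = (\<Union>V\<in>\<W>. X closure_of V)"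
    by (rule closure_of_locally_finite_Union)
  have "disjnt T (X closure_of V)" if "V \<in> \<W>" for V
  proof -
    have "V \<in> \<V>" and VS: "V \<inter> S \<noteq> {}"
      using that by (simp_all add: \<W>_def)
    then obtain U where U: "U \<in> \<U>" "V \<subseteq> U"
      using \<V>(3) by fast
    \<comment> \<open>Meeting \<open>S\<close> rules out the extra member of the cover, so
      \<open>V\<close> lies in a set separated from \<open>T\<close>. An open set disjoint from
      \<open>V\<close> also misses its closure.\<close>
    with VS have "U \<noteq> topspace X - S" by auto
    then obtain W where W: "openin X W" "T \<subseteq> W" "disjnt U W"
      using U(1) by (auto simp: \<U>_def)
    then have "disjnt W V"
      using U(2) by (auto simp: disjnt_def)
    then have "W \<inter> X closure_of V = {}"
      using openin_Int_closure_of_eq_empty[OF W(1)] by (simp add: disjnt_def)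
    then show ?thesis
      using W(2) by (auto simp: disjnt_def)
  qed
  then have "T \<subseteq> topspace X - X closure_of \<Union>\<W>"
    using T unfolding cl disjnt_def by blast
  moreover have "openin X (\<Union>\<W>)"
    using \<V>(1) by (auto simp: \<W>_def)
  moreover have "S \<subseteq> \<Union>\<W>"
    using closedin_subset[OF S] unfolding \<V>(2)[symmetric] \<W>_def by fastforce
  moreover have "disjnt (\<Union>\<W>) (topspace X - X closure_of \<Union>\<W>)"
    using closure_of_subset[OF openin_subset[OF \<open>openin X (\<Union>\<W>)\<close>]] unfolding disjnt_def by blast
  moreover have "openin X (topspace X - X closure_of \<Union>\<W>)"
    by (simp add: openin_diff)
  ultimately show ?thesis by blast
qed

text \<open>Separation is applied twice: the Hausdorff axiom first separates \<open>T\<close> from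
  single points of \<open>S\<close>, and this in turn separates \<open>S\<close> from
  \<open>T\<close>.\<close>

lemma paracompact_Hausdorff_imp_normal_space:
  assumes X: "paracompact_space X" and H: "Hausdorff_space X"
  shows "normal_space X"
  unfolding normal_space_def
proof (intro allI impI, elim conjE)
  fix S T assume S: "closedin X S" and T: "closedin X T" and ST: "disjnt S T"
  have pt: "\<exists>V W. openin X V \<and> openin X W \<and> T \<subseteq> V \<and> {x} \<subseteq> W \<and> disjnt V W" if x: "x \<in> S" for x
  proof (rule paracompact_separation[OF X T])
    show xX: "{x} \<subseteq> topspace X"
      using x closedin_subset[OF S] by blast
    fix y assume "y \<in> T"
    then have "y \<in> topspace X" "y \<noteq> x"
      using closedin_subset[OF T] ST x by (auto simp: disjnt_def)
    with H xX show "\<exists>V W. openin X V \<and> openin X W \<and> y \<in> V \<and> {x} \<subseteq> W \<and> disjnt V W"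
      by (simp add: Hausdorff_space_def)
  qed
  show "\<exists>V W. openin X V \<and> openin X W \<and> S \<subseteq> V \<and> T \<subseteq> W \<and> disjnt V W"
  proof (rule paracompact_separation[OF X S closedin_subset[OF T]])
    fix x assume "x \<in> S"
    from pt[OF this] obtain V W where "openin X V" "openin X W" "T \<subseteq> V" "{x} \<subseteq> W" "disjnt V W"
      by auto
    then show "\<exists>V W. openin X V \<and> openin X W \<and> x \<in> V \<and> T \<subseteq> W \<and> disjnt V W"
      by (intro exI[of _ W] exI[of _ V]) (simp add: disjnt_sym)
  qed
qed

section \<open>Continuity on products with a compact factor\<close>

lemma continuous_map_unit_interval:
  "continuous_map X unit_interval f \<longleftrightarrow>
     continuous_map X euclideanreal f \<and> (\<forall>x\<in>topspace X. 0 \<le> f x \<and> f x \<le> 1)"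
  by (auto simp: continuous_map_in_subtopology image_subset_iff)

lemma continuous_map_compose_pair:
  assumes "continuous_map (prod_topology X Y) Z F" "continuous_map W X f" "continuous_map W Y g"
  shows "continuous_map W Z (\<lambda>w. F (f w, g w))"
  using continuous_map_compose[OF continuous_map_pairedI[OF assms(2,3)] assms(1)]
  by (simp add: o_def)

lemma openin_tube:
  assumes "compact_space K" and W: "openin (prod_topology X K) W"
  shows "openin X {x \<in> topspace X. {x} \<times> topspace K \<subseteq> W}" (is "openin X ?T")
proof (subst openin_subopen, intro ballI)
  fix x assume x: "x \<in> ?T"
  then obtain U V where "openin X U" "openin K V" "x \<in> U" "topspace K \<subseteq> V" "U \<times> V \<subseteq> W"
    using tube_lemma_right[OF W, of "topspace K" x] assms(1) by (auto simp: compact_space_def)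
  then show "\<exists>T. openin X T \<and> x \<in> T \<and> T \<subseteq> ?T"
    by (intro exI[of _ U]) (auto dest: openin_subset)
qed

text \<open>The supremum is attained, so it lies below \<open>a\<close> exactly when all values do,
  an open condition by the tube lemma. The set where it exceeds \<open>a\<close> is the projection
  of an open set.\<close>

lemma continuous_map_compact_Sup:
  fixes f :: "'a \<times> 'b \<Rightarrow> real"
  assumes K: "compact_space K" "topspace K \<noteq> {}"
    and f: "continuous_map (prod_topology X K) euclideanreal f"
  shows "continuous_map X euclideanreal (\<lambda>x. SUP k\<in>topspace K. f (x, k))"
    and "\<And>x k. x \<in> topspace X \<Longrightarrow> k \<in> topspace K \<Longrightarrow> f (x, k) \<le> (SUP k\<in>topspace K. f (x, k))"
proof -
  have compact: "compact ((\<lambda>k. f (x, k)) ` topspace K)" if "x \<in> topspace X" for x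
  proof -
    have "continuous_map K euclideanreal (\<lambda>k. f (x, k))"
      using that by (intro continuous_map_compose_pair[OF f]) auto
    then show ?thesis
      using K(1) image_compactin unfolding compact_space_def by fastforce
  qed
  then have bdd: "bdd_above ((\<lambda>k. f (x, k)) ` topspace K)" if "x \<in> topspace X" for x
    using that by (simp add: compact_imp_bounded bounded_imp_bdd_above)
  then show le: "f (x, k) \<le> (SUP k\<in>topspace K. f (x, k))"
    if "x \<in> topspace X" "k \<in> topspace K" for x k
    using that by (intro cSUP_upper bdd)
  have gt: "a < (SUP k\<in>topspace K. f (x, k)) \<longleftrightarrow> (\<exists>k\<in>topspace K. a < f (x, k))"
    if "x \<in> topspace X" for x a
    using less_cSUP_iff[OF K(2) bdd[OF that]] .
  have lt: "(SUP k\<in>topspace K. f (x, k)) < a \<longleftrightarrow> (\<forall>k\<in>topspace K. f (x, k) < a)"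
    if x: "x \<in> topspace X" for x a
  proof
    assume *: "\<forall>k\<in>topspace K. f (x, k) < a"
    obtain k where "k \<in> topspace K" "\<forall>l\<in>topspace K. f (x, l) \<le> f (x, k)"
      using compact_attains_sup[OF compact[OF x]] K(2) by auto
    then show "(SUP k\<in>topspace K. f (x, k)) < a"
      using * cSUP_least[OF K(2), of "\<lambda>k. f (x, k)" "f (x, k)"] by fastforce
  next
    assume "(SUP k\<in>topspace K. f (x, k)) < a"
    then show "\<forall>k\<in>topspace K. f (x, k) < a"
      using le[OF x] by fastforce
  qed
  show "continuous_map X euclideanreal (\<lambda>x. SUP k\<in>topspace K. f (x, k))"
    unfolding continuous_map_upper_lower_semicontinuous_lt
  proof (intro allI conjI)
    fix a
    have "openin (prod_topology X K) {z \<in> topspace (prod_topology X K). f z < a}"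
      using f unfolding continuous_map_upper_lower_semicontinuous_lt by blast
    from openin_tube[OF K(1) this]
    show "openin X {x \<in> topspace X. (SUP k\<in>topspace K. f (x, k)) < a}"
      by (rule back_subst[where P = "openin X"]) (auto simp: lt subset_iff)
    have "openin (prod_topology X K) {z \<in> topspace (prod_topology X K). a < f z}"
      using f unfolding continuous_map_upper_lower_semicontinuous_lt by blast
    then have "openin X (fst ` {z \<in> topspace (prod_topology X K). a < f z})"
      using open_map_fst unfolding open_map_def by blast
    then show "openin X {x \<in> topspace X. a < (SUP k\<in>topspace K. f (x, k))}"
      by (rule back_subst[where P = "openin X"]) (force simp: gt image_iff)
  qed
qed

section \<open>Deformations near a closed cofibration and relative lifting\<close>

text \<open>The stopped homotopy \<open>H (x, min t (u x))\<close> and the remaining time \<open>max 0 (t - u x)\<close>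
  together retract \<open>X \<times> [0,1]\<close> onto \<open>X \<times> {0} \<union> A \<times> [0,1]\<close>. Points with \<open>u x = 1\<close>
  need not end in \<open>A\<close>.\<close>

definition ndr_pair :: "'a topology \<Rightarrow> 'a set \<Rightarrow> ('a \<times> real \<Rightarrow> 'a) \<Rightarrow> ('a \<Rightarrow> real) \<Rightarrow> bool" where
  "ndr_pair X A H u \<longleftrightarrow>
     continuous_map (prod_topology X unit_interval) X H \<and> continuous_map X unit_interval u \<and>
     (\<forall>x\<in>topspace X. H (x, 0) = x) \<and>
     (\<forall>a\<in>A. u a = 0 \<and> (\<forall>t\<in>{0..1}. H (a, t) = a)) \<and>
     (\<forall>x\<in>topspace X. u x < 1 \<longrightarrow> H (x, u x) \<in> A)"

text \<open>Homotopy extension yields a retraction \<open>R\<close> of the cylinder onto its bottom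
  together with the cylinder over the image of \<open>i\<close>. After slowing, its first coordinate
  is \<open>H\<close>, and the greatest lag of its second coordinate behind time is
  \<open>u\<close>. Normality supplies the slowing factor.\<close>

lemma closed_cofibration_imp_ndr_pair:
  assumes cof: "closed_cofibration A X i" and normal: "normal_space X"
    and U: "openin X U" and AU: "i ` topspace A \<subseteq> U"
  obtains H u where "ndr_pair (subtopology X U) (i ` topspace A) H u"
proof -
  let ?D = "i ` topspace A" and ?XI = "prod_topology X unit_interval"
  have D: "closedin X ?D" and i: "continuous_map A X i"
    using cof by (auto simp: closed_cofibration_def cofibration_def)
  have DX: "?D \<subseteq> topspace X" by (rule closedin_subset[OF D])
  define Z where "Z = subtopology ?XI {(x, t). t = 0 \<or> x \<in> ?D}"
  have f: "continuous_map X Z (\<lambda>x. (x, 0))"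
    unfolding Z_def by (auto simp: continuous_map_in_subtopology intro!: continuous_map_pairedI)
  have "continuous_map (prod_topology A unit_interval) X (\<lambda>z. i (fst z))"
    using continuous_map_compose[OF continuous_map_fst i] by (simp add: o_def)
  then have h: "continuous_map (prod_topology A unit_interval) Z (\<lambda>z. (i (fst z), snd z))"
    unfolding Z_def
    by (auto simp: continuous_map_in_subtopology intro!: continuous_map_pairedI continuous_map_snd)
  \<comment> \<open>\<open>Z\<close> does not live on the type used in the definition of
    \<open>cofibration\<close>, so the extension property comes from
    \<open>cofibration_extension\<close>.\<close>
  have "homotopy_extension_property A X i Z"
    using cof by (simp add: closed_cofibration_def cofibration_extension)
  then obtain R where R: "continuous_map ?XI Z R"
    and R0: "\<forall>x\<in>topspace X. R (x, 0) = (x, 0)"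
    and RD: "\<forall>a\<in>topspace A. \<forall>t\<in>{0..1}. R (i a, t) = (i a, t)"
    unfolding homotopy_extension_property_def
    by (auto dest!: spec[of _ "\<lambda>x. (x, 0)"] spec[of _ "\<lambda>z. (i (fst z), snd z)"] simp: f h)
  have fstZ: "continuous_map Z X fst" and sndZ: "continuous_map Z unit_interval snd"
    unfolding Z_def
    by (auto intro: continuous_map_from_subtopology continuous_map_fst continuous_map_snd)
  have R1: "continuous_map ?XI X (\<lambda>z. fst (R z))"
    using continuous_map_compose[OF R fstZ] by (simp add: o_def)
  \<comment> \<open>The points whose whole track stays in \<open>U\<close>. Compactness of the
    interval makes this set open, and it contains \<open>?D\<close> because \<open>R\<close> fixes
    the cylinder over \<open>?D\<close>.\<close>
  define W where "W = {x \<in> topspace X. \<forall>t\<in>{0..1}. fst (R (x, t)) \<in> U}"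
  have "openin ?XI {z \<in> topspace ?XI. fst (R z) \<in> U}"
    using R1 U by (auto simp: continuous_map_def)
  from openin_tube[OF _ this] have "openin X W"
    by (rule back_subst[where P = "openin X"]) (auto simp: W_def compact_space_subtopology subset_iff)
  then have W: "closedin X (topspace X - W)"
    by (intro closedin_diff closedin_topspace)
  have "?D \<subseteq> W" using DX RD AU by (auto simp: W_def)
  then have "disjnt (topspace X - W) ?D" by (auto simp: disjnt_def)
  then obtain l where l: "continuous_map X unit_interval l"
      "l ` (topspace X - W) \<subseteq> {0}" "l ` ?D \<subseteq> {1}"
    using Urysohn_lemma[OF normal W D, of 0 1] by auto
  have l01: "0 \<le> l x" "l x \<le> 1" if "x \<in> topspace X" for x
    using l(1) that by (auto simp: continuous_map_unit_interval)
  have lt: "0 \<le> l x * t \<and> l x * t \<le> 1" if "x \<in> topspace X" "0 \<le> t" "t \<le> 1" for x t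
    using l01[OF that(1)] that by (simp add: mult_le_one)
  \<comment> \<open>Slowing \<open>R\<close> down by \<open>l\<close> keeps the tracks of points of \<open>U\<close> inside \<open>U\<close>.\<close>
  define Q where "Q = (\<lambda>z. R (fst z, l (fst z) * snd z))"
  have lc: "continuous_map ?XI euclideanreal (\<lambda>z. l (fst z))"
    using continuous_map_compose[OF continuous_map_fst, of X euclideanreal l unit_interval] l(1)
    by (simp add: o_def continuous_map_unit_interval)
  have sc: "continuous_map ?XI euclideanreal snd"
    using continuous_map_snd[of X unit_interval] unfolding continuous_map_unit_interval by blast
  have Q: "continuous_map ?XI Z Q"
    unfolding Q_def
    by (rule continuous_map_compose_pair[OF R continuous_map_fst])
      (auto simp: continuous_map_unit_interval lt intro!: continuous_map_real_mult lc sc)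
  have Q0: "Q (x, 0) = (x, 0)" if "x \<in> topspace X" for x
    using that by (simp add: Q_def R0)
  have QD: "Q (x, t) = (x, t)" if "x \<in> ?D" "0 \<le> t" "t \<le> 1" for x t
  proof -
    have "l x = 1" using l(3) that(1) by blast
    then show ?thesis using RD that by (force simp: Q_def)
  qed
  have QZ: "Q (x, t) \<in> topspace Z" if "x \<in> topspace X" "0 \<le> t" "t \<le> 1" for x t
    using Q that by (auto simp: continuous_map_def)
  define H where "H = (\<lambda>z. fst (Q z))"
  have H: "continuous_map ?XI X H"
    unfolding H_def using continuous_map_compose[OF Q fstZ] by (simp add: o_def)
  have HU: "H (x, t) \<in> U" if "x \<in> U" "0 \<le> t" "t \<le> 1" for x t
  proof (cases "x \<in> W")
    case True
    then show ?thesis using lt[of x t] that by (auto simp: W_def H_def Q_def)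
  next
    case False
    have "x \<in> topspace X" using that U openin_subset by blast
    moreover from this have "l x = 0" using False l(2) by blast
    ultimately show ?thesis
      using R0 that by (simp add: H_def Q_def)
  qed
  have "continuous_map ?XI euclideanreal (\<lambda>z. snd (Q z))"
    using continuous_map_compose[OF Q sndZ] by (simp add: o_def continuous_map_unit_interval)
  then have d: "continuous_map ?XI euclideanreal (\<lambda>z. snd z - snd (Q z))"
    by (intro continuous_map_diff sc)
  \<comment> \<open>For \<open>t\<close> beyond \<open>u x\<close> the second coordinate of
    \<open>Q (x, t)\<close> is positive, and a point of \<open>Z\<close> with positive second
    coordinate has its first coordinate in \<open>?D\<close>.\<close>
  define u where "u = (\<lambda>x. SUP t\<in>{0..1}. t - snd (Q (x, t)))"
  have u: "continuous_map X euclideanreal u"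
    using continuous_map_compact_Sup(1)[OF _ _ d] by (simp add: compact_space_subtopology u_def)
  have u_ge: "t - snd (Q (x, t)) \<le> u x" if "x \<in> topspace X" "0 \<le> t" "t \<le> 1" for x t
    using continuous_map_compact_Sup(2)[OF _ _ d, of x t] that
    by (simp add: compact_space_subtopology u_def)
  have u_le: "u x \<le> 1" if "x \<in> topspace X" for x
    unfolding u_def using QZ[OF that] by (intro cSUP_least) (force simp: Z_def)+
  have u_D: "u x = 0" if "x \<in> ?D" for x
    unfolding u_def using QD[OF that] by simp
  have u_0: "0 \<le> u x" if "x \<in> topspace X" for x
    using u_ge[OF that, of 0] Q0[OF that] by simp
  have HD: "H (x, u x) \<in> ?D" if x: "x \<in> topspace X" and lt1: "u x < 1" for x
  proof -
    \<comment> \<open>The bound \<open>u_ge\<close> only covers times after \<open>u x\<close>. The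
      time \<open>u x\<close> itself is a limit of these, as \<open>u x < 1\<close>, and the times
      at which the track lies in the closed set \<open>?D\<close> form a closed set.\<close>
    have "continuous_map unit_interval X (\<lambda>t. H (x, t))"
      using x by (intro continuous_map_compose_pair[OF H]) auto
    then have "closedin unit_interval {t \<in> topspace unit_interval. H (x, t) \<in> ?D}"
      using D by (simp only: continuous_map_closedin)
    then have "closed {t \<in> {0..1}. H (x, t) \<in> ?D}"
      by (simp add: closedin_closed_eq)
    moreover have "{u x<..1} \<subseteq> {t \<in> {0..1}. H (x, t) \<in> ?D}"
    proof
      fix t assume t: "t \<in> {u x<..1}"
      then have "0 \<le> t" "t \<le> 1" "snd (Q (x, t)) \<noteq> 0"
        using u_0[OF x] u_ge[OF x, of t] by auto
      then show "t \<in> {t \<in> {0..1}. H (x, t) \<in> ?D}"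
        using QZ[OF x, of t] by (auto simp: Z_def H_def)
    qed
    ultimately have "closure {u x<..1} \<subseteq> {t \<in> {0..1}. H (x, t) \<in> ?D}"
      by (simp add: closure_minimal)
    then show ?thesis using lt1 by (auto dest: subsetD[of _ _ "u x"])
  qed
  have UX: "U \<subseteq> topspace X" using U openin_subset by blast
  have "continuous_map (prod_topology (subtopology X U) unit_interval) (subtopology X U) H"
    using UX HU H
    by (auto simp: prod_topology_subtopology(1) continuous_map_in_subtopology
        intro: continuous_map_from_subtopology)
  moreover have "continuous_map (subtopology X U) unit_interval u"
    using UX u u_le u_0
    by (auto simp: continuous_map_unit_interval intro: continuous_map_from_subtopology)
  ultimately have "ndr_pair (subtopology X U) ?D H u"
    unfolding ndr_pair_def using UX AU DX u_D HD QD Q0 by (auto simp: H_def)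
  then show ?thesis by (rule that)
qed

text \<open>Used with \<open>T\<close> the unit interval, since the lifting problem for a section
  lives over \<open>U\<close> times the path parameter. The homotopy leaves the new factor
  fixed.\<close>

lemma ndr_pair_times:
  assumes "ndr_pair X A H u"
  shows "ndr_pair (prod_topology X T) (A \<times> topspace T)
           (\<lambda>z. (H (fst (fst z), snd z), snd (fst z))) (\<lambda>z. u (fst z))"
proof -
  have H: "continuous_map (prod_topology X unit_interval) X H"
    and u: "continuous_map X unit_interval u"
    using assms by (auto simp: ndr_pair_def)
  let ?P = "prod_topology (prod_topology X T) unit_interval"
  have "continuous_map ?P (prod_topology X T) (\<lambda>z. (H (fst (fst z), snd z), snd (fst z)))"
    by (intro continuous_map_pairedI continuous_map_compose_pair[OF H] continuous_map_snd
        continuous_map_compose[OF continuous_map_fst continuous_map_fst, unfolded o_def]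
        continuous_map_compose[OF continuous_map_fst continuous_map_snd, unfolded o_def])
  moreover have "continuous_map (prod_topology X T) unit_interval (\<lambda>z. u (fst z))"
    using continuous_map_compose[OF continuous_map_fst u] by (simp add: o_def)
  ultimately show ?thesis
    using assms by (auto simp: ndr_pair_def)
qed

text \<open>Stroem's relative lifting property: the homotopy \<open>b\<close> joins \<open>K \<circ> r\<close>, over which \<open>g \<circ> r\<close>
  lies, to \<open>K\<close>. It reaches \<open>K\<close> already at time \<open>m\<close>, and evaluating its lift at time \<open>m\<close> leaves \<open>g\<close>
  unchanged on the subspace because \<open>m\<close> vanishes there.\<close>

lemma fibration_relative_lifting:
  assumes p: "hurewicz_fibration E B p" and ndr: "ndr_pair X A H u"
    and g: "continuous_map (subtopology (prod_topology X unit_interval) {(x, t). t = 0 \<or> x \<in> A}) E g"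
    and K: "continuous_map (prod_topology X unit_interval) B K"
    and pg: "\<And>x t. x \<in> topspace X \<Longrightarrow> t \<in> {0..1} \<Longrightarrow> t = 0 \<or> x \<in> A \<Longrightarrow> p (g (x, t)) = K (x, t)"
  obtains G where "continuous_map (prod_topology X unit_interval) E G"
    and "\<And>x t. x \<in> topspace X \<Longrightarrow> t \<in> {0..1} \<Longrightarrow> p (G (x, t)) = K (x, t)"
    and "\<And>x t. x \<in> topspace X \<Longrightarrow> t \<in> {0..1} \<Longrightarrow> t = 0 \<or> x \<in> A \<Longrightarrow> G (x, t) = g (x, t)"
proof -
  let ?Y = "prod_topology X unit_interval"
  have H: "continuous_map ?Y X H" and u: "continuous_map X euclideanreal u"
    and u01: "\<And>x. x \<in> topspace X \<Longrightarrow> 0 \<le> u x \<and> u x \<le> 1"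
    and H0: "\<And>x. x \<in> topspace X \<Longrightarrow> H (x, 0) = x"
    and uA: "\<And>x. x \<in> A \<Longrightarrow> u x = 0"
    and HA: "\<And>x. x \<in> topspace X \<Longrightarrow> u x < 1 \<Longrightarrow> H (x, u x) \<in> A"
    using ndr by (auto simp: ndr_pair_def continuous_map_unit_interval)
  have HX: "H (x, t) \<in> topspace X" if "x \<in> topspace X" "t \<in> {0..1}" for x t
    using H that by (auto simp: continuous_map_def)
  define m where "m = (\<lambda>z. min (snd z) (u (fst z)))"
  have uc: "continuous_map ?Y euclideanreal (\<lambda>z. u (fst z))"
    using continuous_map_compose[OF continuous_map_fst u, of unit_interval] by (simp add: o_def)
  have sc: "continuous_map ?Y euclideanreal snd"
    using continuous_map_snd[of X unit_interval] unfolding continuous_map_unit_interval by blast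
  have mc: "continuous_map ?Y euclideanreal m"
    unfolding m_def by (intro continuous_map_real_min sc uc)
  have m01: "0 \<le> m z \<and> m z \<le> 1" if "z \<in> topspace ?Y" for z
    using that u01 by (auto simp: m_def min_def)
  define r where "r = (\<lambda>z. (H (fst z, m z), max 0 (snd z - u (fst z))))"
  have r: "continuous_map ?Y (subtopology ?Y {(x, t). t = 0 \<or> x \<in> A}) r"
    unfolding continuous_map_in_subtopology
  proof
    show "continuous_map ?Y ?Y r"
      unfolding r_def
    proof (intro continuous_map_pairedI continuous_map_compose_pair[OF H] continuous_map_fst)
      show "continuous_map ?Y unit_interval m"
        using mc m01 by (simp add: continuous_map_unit_interval)
      show "continuous_map ?Y unit_interval (\<lambda>z. max 0 (snd z - u (fst z)))"
        using u01 by (fastforce simp: continuous_map_unit_interval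
            intro!: continuous_map_real_max[of _ "\<lambda>_. 0"] continuous_map_diff sc uc)
    qed
    show "r \<in> topspace ?Y \<rightarrow> {(x, t). t = 0 \<or> x \<in> A}"
    proof
      fix z assume "z \<in> topspace ?Y"
      then obtain x t where "z = (x, t)" "x \<in> topspace X" "t \<le> 1" by auto
      \<comment> \<open>If \<open>t \<le> u x\<close>, no time remains. Otherwise
        \<open>u x < t \<le> 1\<close>, so the stopped point lies in \<open>A\<close>.\<close>
      then show "r z \<in> {(x, t). t = 0 \<or> x \<in> A}"
        using HA[of x] by (cases "t \<le> u x") (auto simp: r_def m_def)
    qed
  qed
  \<comment> \<open>As \<open>v\<close> grows to \<open>m z\<close>, \<open>H\<close> is rewound and
    the same amount of time is given back to the second coordinate, which never exceeds
    \<open>t\<close>. At \<open>v = m z\<close> the identity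
    \<open>max 0 (t - u x) + min t (u x) = t\<close> yields \<open>K (x, t)\<close>.\<close>
  define b where "b = (\<lambda>(z, v). K (H (fst z, max 0 (m z - v)), max 0 (snd z - u (fst z)) + min v (m z)))"
  let ?YI = "prod_topology ?Y unit_interval"
  have fstc: "continuous_map ?YI euclideanreal (\<lambda>w. f (fst w))" if "continuous_map ?Y euclideanreal f" for f
    using continuous_map_compose[OF continuous_map_fst that, of unit_interval] by (simp add: o_def)
  have sYI: "continuous_map ?YI euclideanreal snd"
    using continuous_map_snd[of ?Y unit_interval] unfolding continuous_map_unit_interval by blast
  have b: "continuous_map ?YI B b"
    unfolding b_def case_prod_beta
  proof (rule continuous_map_compose_pair[OF K continuous_map_compose_pair[OF H]])
    show "continuous_map ?YI X (\<lambda>w. fst (fst w))"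
      by (rule continuous_map_compose[OF continuous_map_fst continuous_map_fst, unfolded o_def])
    show "continuous_map ?YI unit_interval (\<lambda>w. max 0 (m (fst w) - snd w))"
      unfolding continuous_map_unit_interval
    proof
      show "continuous_map ?YI euclideanreal (\<lambda>w. max 0 (m (fst w) - snd w))"
        by (intro continuous_map_real_max[of _ "\<lambda>_. 0"] continuous_map_diff fstc sYI mc) simp
      show "\<forall>w\<in>topspace ?YI. 0 \<le> max 0 (m (fst w) - snd w) \<and> max 0 (m (fst w) - snd w) \<le> 1"
        using m01 by fastforce
    qed
    show "continuous_map ?YI unit_interval
        (\<lambda>w. max 0 (snd (fst w) - u (fst (fst w))) + min (snd w) (m (fst w)))"
      unfolding continuous_map_unit_interval
    proof (intro conjI ballI)
      show "continuous_map ?YI euclideanreal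
          (\<lambda>w. max 0 (snd (fst w) - u (fst (fst w))) + min (snd w) (m (fst w)))"
        by (intro continuous_map_add continuous_map_real_max[of _ "\<lambda>_. 0"] continuous_map_real_min
            continuous_map_diff fstc sYI mc sc uc) simp
      fix w assume "w \<in> topspace ?YI"
      then obtain x t v where w: "w = ((x, t), v)" "x \<in> topspace X" "0 \<le> t" "t \<le> 1" "0 \<le> v"
        by auto
      then have "0 \<le> u x" using u01 by blast
      with w show "0 \<le> max 0 (snd (fst w) - u (fst (fst w))) + min (snd w) (m (fst w))"
        "max 0 (snd (fst w) - u (fst (fst w))) + min (snd w) (m (fst w)) \<le> 1"
        by (auto simp: m_def)
    qed
  qed
  have gr: "continuous_map ?Y E (\<lambda>z. g (r z))"
    using continuous_map_compose[OF r g] by (simp add: o_def)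
  have b0: "b (z, 0) = p (g (r z))" if z: "z \<in> topspace ?Y" for z
  proof -
    have "r z \<in> topspace (subtopology ?Y {(x, t). t = 0 \<or> x \<in> A})"
      using continuous_map_image_subset_topspace[OF r] z by blast
    then have "p (g (r z)) = K (r z)"
      using pg[of "fst (r z)" "snd (r z)"] by (simp add: case_prod_beta mem_Times_iff)
    then show ?thesis
      using m01[OF z] by (simp add: b_def r_def)
  qed
  have "homotopy_lifting_property ?Y E B p"
    using hurewicz_fibration_lifting[OF p] .
  then have "\<exists>F. continuous_map ?YI E F \<and> (\<forall>z\<in>topspace ?Y. F (z, 0) = g (r z)) \<and>
      (\<forall>z\<in>topspace ?Y. \<forall>v\<in>{0..1}. p (F (z, v)) = b (z, v))"
    unfolding homotopy_lifting_property_def using gr b b0 by blast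
  then obtain F where F: "continuous_map ?YI E F"
    and F0: "\<And>z. z \<in> topspace ?Y \<Longrightarrow> F (z, 0) = g (r z)"
    and pF: "\<And>z v. z \<in> topspace ?Y \<Longrightarrow> v \<in> {0..1} \<Longrightarrow> p (F (z, v)) = b (z, v)"
    by blast
  show ?thesis
  proof
    show "continuous_map ?Y E (\<lambda>z. F (z, m z))"
      using mc m01 by (intro continuous_map_compose_pair[OF F])
        (auto simp: continuous_map_unit_interval)
    fix x t assume x: "x \<in> topspace X" and t: "t \<in> {0..1::real}"
    then have z: "(x, t) \<in> topspace ?Y" by simp
    show "p (F ((x, t), m (x, t))) = K (x, t)"
      using pF[OF z, of "m (x, t)"] m01[OF z] H0[OF x]
      by (simp add: b_def) (simp add: m_def min_def max_def)
    assume *: "t = 0 \<or> x \<in> A"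
    then have "m (x, t) = 0"
      using uA u01[OF x] t by (auto simp: m_def min_def)
    moreover from this have "r (x, t) = (x, t)"
      using * uA u01[OF x] t H0[OF x] by (auto simp: r_def max_def)
    ultimately show "F ((x, t), m (x, t)) = g (x, t)"
      using F0[OF z] by simp
  qed
qed

section \<open>Sections of the endpoint map and how to make them strict\<close>

text \<open>Evaluation is continuous because the interval has a base of compact neighbourhoods.
  Together with \<open>section_curry\<close> this trades sections for maps on a product with the
  interval, where lifting applies.\<close>

lemma section_uncurry:
  assumes "continuous_section_over (fibrewise_path_space E p) X path_endpoints U s"
  shows "continuous_map (prod_topology (subtopology X U) unit_interval) E (\<lambda>z. s (fst z) (snd z))"
proof -
  have "continuous_map (subtopology X U) (compact_open unit_interval E) s"
    using assms
    by (simp add: continuous_section_over_def fibrewise_path_space_def continuous_map_in_subtopology)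
  then have "continuous_map (prod_topology (subtopology X U) unit_interval)
      (compact_open unit_interval E) (\<lambda>z. s (fst z))"
    using continuous_map_compose[OF continuous_map_fst] by (fastforce simp: o_def)
  from continuous_map_compose_pair[OF continuous_map_eval_compact_open this continuous_map_snd]
  show ?thesis
    by (simp add: neighbourhood_base_unit_interval)
qed

lemma section_path:
  assumes s: "continuous_section_over (fibrewise_path_space E p) X path_endpoints U s"
    and x: "x \<in> topspace X" "x \<in> U" and t: "t \<in> {0..1}"
  shows "s x 0 = fst x" "s x 1 = snd x" "p (s x t) = p (fst x)"
proof -
  have "path_endpoints (s x) = x"
    using s x by (simp add: continuous_section_over_def)
  then show 0: "s x 0 = fst x" and "s x 1 = snd x"
    by (simp_all add: path_endpoints_def prod_eq_iff)
  have "s x \<in> topspace (fibrewise_path_space E p)"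
    using s x by (auto simp: continuous_section_over_def continuous_map_def)
  then obtain b where "\<forall>t\<in>{0..1}. p (s x t) = b"
    by (auto simp: fibrewise_path_space_def)
  then show "p (s x t) = p (fst x)"
    using t 0 by (metis atLeastAtMost_iff order_refl zero_le_one)
qed

lemma section_curry:
  assumes S: "continuous_map (prod_topology (subtopology X U) unit_interval) E S"
    and UX: "U \<subseteq> topspace X"
    and ends: "\<And>x. x \<in> U \<Longrightarrow> S (x, 0) = fst x \<and> S (x, 1) = snd x"
    and pS: "\<And>x t. x \<in> U \<Longrightarrow> t \<in> {0..1} \<Longrightarrow> p (S (x, t)) = f x"
  shows "continuous_section_over (fibrewise_path_space E p) X path_endpoints U
           (\<lambda>x. restrict (\<lambda>t. S (x, t)) {0..1})"
  using continuous_map_curry_compact_open[OF S] ends UX pS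
  by (auto simp: continuous_section_over_def fibrewise_path_space_def path_endpoints_def
      continuous_map_in_subtopology)

text \<open>The homotopy to be lifted is constant in \<open>B\<close>, so its lift moves within
  fibres, and the strict section is read off three sides of the lifted square.\<close>

lemma strict_section_of_section:
  assumes p: "hurewicz_fibration E B p"
    and ndr: "ndr_pair (subtopology (fibre_product E p) U) (diagonal E) H u"
    and UX: "U \<subseteq> topspace (fibre_product E p)" and diagU: "diagonal E \<subseteq> U"
    and s: "continuous_section_over (fibrewise_path_space E p) (fibre_product E p) path_endpoints U s"
  obtains \<sigma> where
    "continuous_section_over (fibrewise_path_space E p) (fibre_product E p) path_endpoints U \<sigma>"
    "\<And>e. e \<in> topspace E \<Longrightarrow> \<sigma> (e, e) = constant_path e"
proof -
  let ?X = "fibre_product E p"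
  let ?Y = "subtopology ?X U"
  let ?YI = "prod_topology ?Y unit_interval"
  let ?YII = "prod_topology ?YI unit_interval"
  have topY: "topspace ?Y = U" using UX by auto
  have fstX: "continuous_map ?Y E fst"
    unfolding fibre_product_def by (intro continuous_map_from_subtopology continuous_map_fst)
  have UE: "fst x \<in> topspace E" if "x \<in> U" for x
    using that UX by (auto simp: fibre_product_def)
  have diag_iff: "x \<in> diagonal E \<longleftrightarrow> fst x \<in> topspace E \<and> x = (fst x, fst x)" for x
    by (auto simp: diagonal_def diagonal_map_def)
  \<comment> \<open>The section at \<open>d x\<close> is a loop at the first entry of
    \<open>x\<close>; its reverse starts the concatenation. It is available because \<open>U\<close>
    contains the diagonal.\<close>
  define d where "d = (\<lambda>x::'a \<times> 'a. (fst x, fst x))"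
  have dU: "d x \<in> U" if "x \<in> U" for x
    using that UE diagU diag_iff[of "d x"] by (auto simp: d_def)
  have "continuous_map ?Y (prod_topology E E) d"
    unfolding d_def by (intro continuous_map_pairedI fstX)
  then have d: "continuous_map ?Y ?Y d"
    using dU topY by (auto simp: continuous_map_in_subtopology fibre_product_def d_def)
  note S = section_uncurry[OF s]
  have path: "s x 0 = fst x" "s x 1 = snd x" if "x \<in> U" for x
    using section_path[OF s, of x 0] that UX by auto
  have ps: "p (s x t) = p (fst x)" if "x \<in> U" "t \<in> {0..1}" for x t
    using section_path(3)[OF s, of x t] that UX by blast

  \<comment> \<open>At height 0, \<open>g\<close> is the concatenation of the reverse of \<open>s (e1, e1)\<close> with \<open>s (e1, e2)\<close>.
    On the diagonal it contracts this loop, which at height \<open>h\<close> goes back only to time \<open>h\<close> before returning.\<close>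
  define g where "g = (\<lambda>z. if snd (fst z) \<le> 1/2
      then s (d (fst (fst z))) (max (1 - 2 * snd (fst z)) (snd z))
      else s (fst (fst z)) (max (2 * snd (fst z) - 1) (snd z)))"
  let ?C = "{(y, t). t = 0 \<or> y \<in> diagonal E \<times> topspace unit_interval}"
  have xc: "continuous_map ?YII ?Y (\<lambda>z. fst (fst z))"
    by (rule continuous_map_compose[OF continuous_map_fst continuous_map_fst, unfolded o_def])
  have tc: "continuous_map ?YII euclideanreal (\<lambda>z. snd (fst z))"
    using continuous_map_compose[OF continuous_map_fst continuous_map_snd, of ?Y unit_interval unit_interval]
    by (simp add: o_def continuous_map_unit_interval)
  have vc: "continuous_map ?YII euclideanreal snd"
    using continuous_map_snd[of ?YI unit_interval] unfolding continuous_map_unit_interval by blast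
  have g1: "continuous_map ?YII E (\<lambda>z. s (d (fst (fst z))) (max (1 - 2 * snd (fst z)) (snd z)))"
  proof -
    have "continuous_map ?YII euclideanreal (\<lambda>z. max (1 - 2 * snd (fst z)) (snd z))"
      by (intro continuous_map_real_max continuous_map_diff continuous_map_real_mult_left tc vc) simp
    then have "continuous_map ?YII unit_interval (\<lambda>z. max (1 - 2 * snd (fst z)) (snd z))"
      by (auto simp: continuous_map_unit_interval le_max_iff_disj)
    from continuous_map_compose_pair[OF S continuous_map_compose[OF xc d] this]
    show ?thesis by simp
  qed
  have g2: "continuous_map ?YII E (\<lambda>z. s (fst (fst z)) (max (2 * snd (fst z) - 1) (snd z)))"
  proof -
    have "continuous_map ?YII euclideanreal (\<lambda>z. max (2 * snd (fst z) - 1) (snd z))"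
      by (intro continuous_map_real_max continuous_map_diff continuous_map_real_mult_left tc vc) simp
    then have "continuous_map ?YII unit_interval (\<lambda>z. max (2 * snd (fst z) - 1) (snd z))"
      by (auto simp: continuous_map_unit_interval le_max_iff_disj)
    from continuous_map_compose_pair[OF S xc this]
    show ?thesis by simp
  qed
  have g: "continuous_map (subtopology ?YII ?C) E g"
    unfolding g_def
  proof (rule continuous_map_cases_le)
    \<comment> \<open>At the seam both parameters equal the height. At height 0 both paths are at
      the first entry of the pair; at positive height only diagonal points occur, and
      \<open>d\<close> fixes them.\<close>
    fix z assume "z \<in> topspace (subtopology ?YII ?C)" and half: "snd (fst z) = 1/2"
    then have z: "fst (fst z) \<in> U" "0 \<le> snd z" "snd z = 0 \<or> fst (fst z) \<in> diagonal E"
      by auto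
    have zero: "1 - 2 * snd (fst z) = 0" "2 * snd (fst z) - 1 = 0"
      using half by auto
    show "s (d (fst (fst z))) (max (1 - 2 * snd (fst z)) (snd z))
        = s (fst (fst z)) (max (2 * snd (fst z) - 1) (snd z))"
    proof (cases "snd z = 0")
      case True
      then show ?thesis using path(1) dU[OF z(1)] z(1) by (simp add: zero d_def)
    next
      case False
      then have "d (fst (fst z)) = fst (fst z)"
        using z(3) diag_iff by (metis d_def)
      then show ?thesis by (simp add: zero)
    qed
  qed (auto intro: continuous_map_from_subtopology g1 g2 tc)
  have pfst: "continuous_map ?YII B (\<lambda>z. p (fst (fst (fst z))))"
    using p continuous_map_compose[OF continuous_map_compose[OF xc fstX]]
    by (fastforce simp: hurewicz_fibration_def o_def)
  have pg: "p (g (y, t)) = p (fst (fst y))" if "y \<in> topspace ?YI" "t \<in> {0..1}" for y t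
  proof (cases y)
    case (Pair x v)
    with that have "x \<in> U" "0 \<le> v" "v \<le> 1" by auto
    then show ?thesis
      using ps[of x "max (2 * v - 1) t"] ps[OF dU, of x "max (1 - 2 * v) t"] that(2)
      by (simp add: Pair g_def d_def)
  qed
  have *: "p (g (y, t)) = (\<lambda>z. p (fst (fst (fst z)))) (y, t)"
    if "y \<in> topspace ?YI" "t \<in> {0..1}" "t = 0 \<or> y \<in> diagonal E \<times> topspace unit_interval" for y t
    using pg[OF that(1,2)] by simp
  obtain G where G: "continuous_map ?YII E G"
    and pG: "\<And>y t. y \<in> topspace ?YI \<Longrightarrow> t \<in> {0..1} \<Longrightarrow> p (G (y, t)) = p (fst (fst y))"
    and Gg: "\<And>y t. y \<in> topspace ?YI \<Longrightarrow> t \<in> {0..1} \<Longrightarrow>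
        t = 0 \<or> y \<in> diagonal E \<times> topspace unit_interval \<Longrightarrow> G (y, t) = g (y, t)"
    by (rule fibration_relative_lifting[OF p ndr_pair_times[OF ndr] g pfst *]) auto

  \<comment> \<open>\<open>(a, b)\<close> runs up the left side, along the top and down the right side of the square.
    On the diagonal \<open>G\<close> is constant there; elsewhere the two sides supply the end points that \<open>G\<close>
    does not fix.\<close>
  define a where "a = (\<lambda>v::real. max 0 (min 1 (3 * v - 1)))"
  define b where "b = (\<lambda>v::real. min 1 (min (3 * v) (3 - 3 * v)))"
  have ab: "a v \<in> {0..1}" "b v \<in> {0..1}" if "v \<in> {0..1}" for v
    using that by (auto simp: a_def b_def)
  have sc: "continuous_map ?YI euclideanreal snd"
    using continuous_map_snd[of ?Y unit_interval] unfolding continuous_map_unit_interval by blast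
  have "continuous_map ?YI unit_interval (\<lambda>z. a (snd z))"
    unfolding continuous_map_unit_interval
  proof
    show "continuous_map ?YI euclideanreal (\<lambda>z. a (snd z))"
      unfolding a_def
      by (intro continuous_map_real_max[of _ "\<lambda>_. 0"] continuous_map_real_min[of _ "\<lambda>_. 1"]
          continuous_map_diff continuous_map_real_mult_left sc) simp_all
  qed (use ab in auto)
  moreover have "continuous_map ?YI unit_interval (\<lambda>z. b (snd z))"
    unfolding continuous_map_unit_interval
  proof
    show "continuous_map ?YI euclideanreal (\<lambda>z. b (snd z))"
      unfolding b_def
      by (intro continuous_map_real_min[of _ "\<lambda>_. 1"] continuous_map_real_min
          continuous_map_diff continuous_map_real_mult_left sc) simp_all
  qed (use ab in auto)
  ultimately have GS: "continuous_map ?YI E (\<lambda>z. G ((fst z, a (snd z)), b (snd z)))"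
    by (intro continuous_map_compose_pair[OF G] continuous_map_pairedI continuous_map_fst)
  show ?thesis
  proof
    show "continuous_section_over (fibrewise_path_space E p) ?X path_endpoints U
        (\<lambda>x. restrict (\<lambda>v. (\<lambda>z. G ((fst z, a (snd z)), b (snd z))) (x, v)) {0..1})"
    proof (rule section_curry[OF GS UX])
      \<comment> \<open>Both ends sit at height 0, on the left and on the right side. There
        \<open>G\<close> agrees with \<open>g\<close>, whose values are \<open>s (d x) 1\<close> and
        \<open>s x 1\<close>.\<close>
      fix x assume x: "x \<in> U"
      then show "G ((fst (x, 0), a (snd (x, 0))), b (snd (x, 0))) = fst x \<and>
          G ((fst (x, 1), a (snd (x, 1))), b (snd (x, 1))) = snd x"
        using path[OF x] path[OF dU[OF x]] UX
        by (auto simp: a_def b_def Gg g_def d_def)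
      fix v :: real assume "v \<in> {0..1}"
      with ab[OF this] x UX show "p (G ((fst (x, v), a (snd (x, v))), b (snd (x, v)))) = p (fst x)"
        by (subst pG) auto
    qed
    fix e assume e: "e \<in> topspace E"
    then have eD: "(e, e) \<in> diagonal E" by (simp add: diag_iff)
    then have eU: "(e, e) \<in> U" using diagU by blast
    have "G (((e, e), a v), b v) = e" if v: "v \<in> {0..1}" for v
    proof -
      have "G (((e, e), a v), b v) = g (((e, e), a v), b v)"
        using eD eU UX ab[OF v] by (intro Gg) auto
      \<comment> \<open>On each of the three sides the parameter occurring in \<open>g\<close> is 1,
        and \<open>s (e, e) 1 = e\<close>.\<close>
      moreover have "a v = 0 \<or> a v = 1 \<or> b v = 1"
        by (auto simp: a_def b_def)
      moreover have "max (1 - 2 * a v) 1 = 1" "max (2 * a v - 1) 1 = 1"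
          "max 1 (b v) = 1"
        using ab[OF v] by auto
      ultimately show ?thesis
        using path(2)[OF eU] by (auto simp: g_def d_def)
    qed
    then show "restrict (\<lambda>v. (\<lambda>z. G ((fst z, a (snd z)), b (snd z))) ((e, e), v)) {0..1} = constant_path e"
      by (auto simp: constant_path_def)
  qed
qed

section \<open>Comparison of the two complexities\<close>

text \<open>Forgetting the conditions on the diagonal leaves an admissible cover, so the left
  infimum runs over a larger set.\<close>

lemma parametrized_TC_le_monoidal: "parametrized_TC E p \<le> monoidal_parametrized_TC E p"
  unfolding parametrized_TC_def monoidal_parametrized_TC_def sectional_category_def
  by (rule Inf_superset_mono) blast

theorem theorem3p13:
  fixes E :: "'e topology" and B :: "'b topology" and p :: "'e \<Rightarrow> 'b"
    and k :: nat and U :: "nat \<Rightarrow> ('e \<times> 'e) set" and s :: "nat \<Rightarrow> 'e \<times> 'e \<Rightarrow> real \<Rightarrow> 'e"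
  assumes "LEC_fibration E B p"
    and "paracompact_space (fibre_product E p)"
    and "Hausdorff_space (fibre_product E p)"
    and "open_cover_upto (fibre_product E p) k U"
    and "\<And>i. i \<le> k \<Longrightarrow>
           continuous_section_over (fibrewise_path_space E p) (fibre_product E p)
             path_endpoints (U i) (s i)"
    and "diagonal E \<subseteq> U 0"
    and "\<And>i. 1 \<le> i \<Longrightarrow> i \<le> k \<Longrightarrow> diagonal E \<inter> U i = {}"
  shows "monoidal_parametrized_TC E p \<le> enat k \<and>
         (parametrized_TC E p = enat k \<longrightarrow>
            monoidal_parametrized_TC E p = parametrized_TC E p \<and>
            parametrized_TC E p = enat k)"
proof -
  let ?X = "fibre_product E p" and ?P = "fibrewise_path_space E p"
  have fib: "hurewicz_fibration E B p" and cof: "closed_cofibration E ?X diagonal_map"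
    using assms(1) by (simp_all add: LEC_fibration_def)
  have normal: "normal_space ?X"
    using paracompact_Hausdorff_imp_normal_space assms(2,3) .
  have U: "\<And>i. i \<le> k \<Longrightarrow> openin ?X (U i)" and cover: "(\<Union>i\<le>k. U i) = topspace ?X"
    using assms(4) by (auto simp: open_cover_upto_def)
  have UX: "U 0 \<subseteq> topspace ?X" using U[of 0] openin_subset by blast
  obtain H u where "ndr_pair (subtopology ?X (U 0)) (diagonal E) H u"
    using closed_cofibration_imp_ndr_pair[OF cof normal U[of 0]] assms(6)
    unfolding diagonal_def by auto
  from strict_section_of_section[OF fib this UX assms(6) assms(5)[of 0]]
  obtain \<sigma> where \<sigma>: "continuous_section_over ?P ?X path_endpoints (U 0) \<sigma>"
    and strict: "\<And>e. e \<in> topspace E \<Longrightarrow> \<sigma> (e, e) = constant_path e"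
    by auto
  have "closedin ?X (diagonal E)"
    using cof by (simp add: closed_cofibration_def diagonal_def)
  moreover have "closedin ?X (topspace ?X - U 0)"
    using U[of 0] by (intro closedin_diff closedin_topspace) auto
  moreover have "disjnt (topspace ?X - U 0) (diagonal E)"
    using assms(6) by (auto simp: disjnt_def)
  ultimately obtain P Q where PQ: "openin ?X P" "openin ?X Q" "topspace ?X - U 0 \<subseteq> P"
      "diagonal E \<subseteq> Q" "disjnt P Q"
    using normal unfolding normal_space_def by meson
  \<comment> \<open>Index 0 keeps all of \<open>U 0\<close>, and the rest of the space lies in
    \<open>P\<close>, so cutting the other \<open>U i\<close> down to \<open>P\<close> loses no
    point of the union. Adding \<open>U 0 \<inter> Q\<close> puts the diagonal into every
    set.\<close>
  define V where "V = (\<lambda>i. if i = 0 then U 0 else (U i \<inter> P) \<union> (U 0 \<inter> Q))"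
  have V: "openin ?X (V i)" if "i \<le> k" for i
    using U[OF that] U[of 0] PQ by (auto simp: V_def)
  have "(\<Union>i\<le>k. V i) = topspace ?X"
  proof
    show "(\<Union>i\<le>k. V i) \<subseteq> topspace ?X"
      using V openin_subset by blast
    show "topspace ?X \<subseteq> (\<Union>i\<le>k. V i)"
    proof
      fix x assume x: "x \<in> topspace ?X"
      show "x \<in> (\<Union>i\<le>k. V i)"
      proof (cases "x \<in> U 0")
        case False
        obtain i where "i \<le> k" "x \<in> U i" using x cover by auto
        moreover have "x \<in> P" using False x PQ(3) by blast
        ultimately have "x \<in> V i" by (auto simp: V_def)
        then show ?thesis using \<open>i \<le> k\<close> by blast
      qed (auto simp: V_def intro: bexI[of _ 0])
    qed
  qed
  with V have Vcover: "open_cover_upto ?X k V"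
    by (simp add: open_cover_upto_def)
  have "\<exists>\<tau>. continuous_section_over ?P ?X path_endpoints (V i) \<tau> \<and>
          (\<forall>e\<in>topspace E. \<tau> (e, e) = constant_path e)" if i: "i \<le> k" for i
  proof (cases "i = 0")
    case True
    then show ?thesis using \<sigma> strict by (auto simp: V_def)
  next
    case False
    \<comment> \<open>A point of \<open>V i\<close> in \<open>Q\<close> lies in \<open>U 0\<close>,
      and one outside \<open>Q\<close> lies in \<open>U i\<close>, so the chosen section is defined
      there.\<close>
    define \<tau> where "\<tau> = (\<lambda>x. if x \<in> Q then \<sigma> x else s i x)"
    have Vi: "V i = (U i \<inter> P) \<union> (U 0 \<inter> Q)" using False by (simp add: V_def)
    have \<tau>_cont: "continuous_map (subtopology ?X (V i)) ?P \<tau>"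
    \<comment> \<open>The two open pieces are indexed by booleans, \<open>True\<close> standing for
      \<open>Q\<close>. They are disjoint, so agreement on overlaps only concerns equal
      indices.\<close>
    proof (rule pasting_lemma[where I = UNIV and T = "\<lambda>c. V i \<inter> (if c then Q else P)"
          and f = "\<lambda>c. if c then \<sigma> else s i"])
      fix c
      show "openin (subtopology ?X (V i)) (V i \<inter> (if c then Q else P))"
        using PQ by (simp add: openin_subtopology_Int2)
      have "V i \<inter> (V i \<inter> Q) \<subseteq> U 0" "V i \<inter> (V i \<inter> P) \<subseteq> U i"
        using PQ(5) by (auto simp: Vi disjnt_def)
      then show "continuous_map (subtopology (subtopology ?X (V i)) (V i \<inter> (if c then Q else P))) ?P
          (if c then \<sigma> else s i)"
        using \<sigma> assms(5)[OF i]
        by (auto simp: subtopology_subtopology continuous_section_over_def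
            intro: continuous_map_from_subtopology_mono)
    next
      fix c c' x
      assume "x \<in> topspace (subtopology ?X (V i)) \<inter> (V i \<inter> (if c then Q else P))
          \<inter> (V i \<inter> (if c' then Q else P))"
      then show "(if c then \<sigma> else s i) x = (if c' then \<sigma> else s i) x"
        using PQ(5) by (auto simp: disjnt_def split: if_splits)
    next
      fix x assume "x \<in> topspace (subtopology ?X (V i))"
      then show "\<exists>c. c \<in> UNIV \<and> x \<in> V i \<inter> (if c then Q else P) \<and> \<tau> x = (if c then \<sigma> else s i) x"
        by (intro exI[of _ "x \<in> Q"]) (auto simp: Vi \<tau>_def)
    qed
    have "path_endpoints (\<tau> x) = x" if "x \<in> V i" for x
      using that \<sigma> assms(5)[OF i] PQ(5)
      by (auto simp: Vi \<tau>_def continuous_section_over_def disjnt_def)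
    moreover have "\<tau> (e, e) = constant_path e" if e: "e \<in> topspace E" for e
    proof -
      have "(e, e) \<in> Q"
        using e PQ(4) by (auto simp: diagonal_def diagonal_map_def)
      then show ?thesis using strict[OF e] by (simp add: \<tau>_def)
    qed
    ultimately show ?thesis
      using \<tau>_cont by (auto simp: continuous_section_over_def)
  qed
  moreover have "diagonal E \<subseteq> V i" for i
    using assms(6) PQ(4) by (auto simp: V_def)
  ultimately have "enat k \<in> {enat n | n. \<exists>V. open_cover_upto ?X n V \<and>
      (\<forall>i\<le>n. diagonal E \<subseteq> V i \<and>
         (\<exists>\<sigma>. continuous_section_over ?P ?X path_endpoints (V i) \<sigma> \<and>
              (\<forall>e\<in>topspace E. \<sigma> (e, e) = constant_path e)))}"
    using Vcover by blast
  then have "monoidal_parametrized_TC E p \<le> enat k"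
    unfolding monoidal_parametrized_TC_def by (rule Inf_lower)
  \<comment> \<open>If \<open>parametrized_TC E p = enat k\<close>, the lower bound by it and the
    upper bound \<open>enat k\<close> coincide.\<close>
  then show ?thesis
    using parametrized_TC_le_monoidal[of E p] by auto
qed

end
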